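(* Let $G=(V,E)$ be a graph with $n=|V|$ nodes and let $x\in\{0,1\}^V$ be an arbitrary configuration. For $r\in V$ and $t\ge 1$ let $c_r^t(x)=|x_r^{t+1}-x_r^{t-1}|$, where $(x^t)_{t\ge 0}$ is the orbit of $x^0=x$ under the majority dynamics on $G$. Then, for every $r\in V$ and every $T>0$, the following hold. \begin{enumerate} \item If $G$ is a graph of sub-exponential growth, then $\sum_{t=1}^{T} c_r^t(x)=\mathcal O(1)$. \item If $G$ is a graph of maximum degree $3$, then $\sum_{t=1}^{T} c_r^t(x)=\mathcal O(\log n)$. \item If $G$ is a graph of maximum degree $\Delta$, then $\sum_{t=1}^{T} c_r^t(x)=\mathcal O(n^{1-\varepsilon})$, where $$\varepsilon=\left(\frac{\log(\Delta+2)}{\log(\Delta)}-1\right)>\frac{1}{\Delta\log(\Delta)}.$$ \end{enumerate}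
   Context: Graphs are finite, simple, undirected and connected. $N(u)$ is the set of neighbors of $u$ and $d(u)=|N(u)|$. A configuration of $G=(V,E)$ is a map $x\in\{0,1\}^V$. Majority dynamics: from $x^0=x$, for every $t\ge 0$ and all nodes $u$ simultaneously, $x_u^{t+1}=1$ if $\sum_{v\in N(u)}x_v^t>d(u)/2$; $x_u^{t+1}=x_u^t$ if $\sum_{v\in N(u)}x_v^t=d(u)/2$; and $x_u^{t+1}=0$ otherwise. The sequence $(x^t)_{t\ge0}$ is the orbit of $x$. Growth: $B(v,k)$ is the set of nodes at distance at most $k$ from $v$, and $\partial B(v,k)=B(v,k)\setminus B(v,k-1)$. Given a function $f:\mathbb N\to\mathbb R$, a node $v$ has $f$-bounded growth if there exist constants $c_1,c_2>0$ such that, for every $k>0$, $c_1 f(k)\le|\partial B(v,k)|\le c_2 f(k)$. A graph has $f$-bounded growth if every one of its nodes has $f$-bounded growth, and a family of graphs has $f$-bounded growth if every graph in it does. Sub-exponential growth means $f$-bounded growth with $f$ a sub-exponential function (that is, $f(k)=2^{o(k)}$). $\log$ denotes the base-2 logarithm. *)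

theory Defs
  imports
    "HOL-Analysis.Analysis"
    "HOL-Library.Landau_Symbols"
    "Graph_Theory.Pair_Digraph"
    "Graph_Theory.Digraph_Component"
    "Graph_Theory.Shortest_Path"
begin

text \<open>
  Undirected graphs are symmetric irreflexive arc relations on a finite vertex set.
  The predicate \<^const>\<open>connected\<close> on digraphs excludes the empty graph.
\<close>
definition connected_graph :: "'a pair_pre_digraph \<Rightarrow> bool" where
  "connected_graph G \<longleftrightarrow> pair_graph G \<and> Digraph_Component.connected (with_proj G)"

definition neighbors :: "'a pair_pre_digraph \<Rightarrow> 'a \<Rightarrow> 'a set" where
  "neighbors G u = {v. (u, v) \<in> parcs G}"

definition degree_of :: "'a pair_pre_digraph \<Rightarrow> 'a \<Rightarrow> nat" where
  "degree_of G u = card (neighbors G u)"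

definition max_degree :: "'a pair_pre_digraph \<Rightarrow> nat" where
  "max_degree G = Max (degree_of G ` pverts G)"

text \<open>Graph distance is the shortest-path distance for unit arc weights.\<close>
definition graph_dist :: "'a pair_pre_digraph \<Rightarrow> 'a \<Rightarrow> 'a \<Rightarrow> ereal" where
  "graph_dist G u v = wf_digraph.\<mu> (with_proj G) (\<lambda>_. 1) u v"

definition graph_ball :: "'a pair_pre_digraph \<Rightarrow> 'a \<Rightarrow> nat \<Rightarrow> 'a set" where
  "graph_ball G v k = {u \<in> pverts G. graph_dist G v u \<le> ereal (real k)}"

text \<open>Only used for \<open>k > 0\<close>; at \<open>k = 0\<close> truncated subtraction makes it empty.\<close>
definition graph_sphere :: "'a pair_pre_digraph \<Rightarrow> 'a \<Rightarrow> nat \<Rightarrow> 'a set" where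
  "graph_sphere G v k = graph_ball G v k - graph_ball G v (k - 1)"

text \<open>
  In a finite graph every sphere beyond the eccentricity of \<open>v\<close> is empty, so requiring the
  lower bound there would force \<open>f\<close> to vanish eventually and bound the number of nodes by a
  constant. The bounds are therefore imposed only at radii at which the sphere is nonempty.
\<close>
definition bounded_growth_at ::
  "(nat \<Rightarrow> real) \<Rightarrow> real \<Rightarrow> real \<Rightarrow> 'a pair_pre_digraph \<Rightarrow> 'a \<Rightarrow> bool" where
  "bounded_growth_at f c\<^sub>1 c\<^sub>2 G v \<longleftrightarrow>
     (\<forall>k>0. graph_sphere G v k \<noteq> {} \<longrightarrow>
        c\<^sub>1 * f k \<le> real (card (graph_sphere G v k)) \<and>
        real (card (graph_sphere G v k)) \<le> c\<^sub>2 * f k)"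

text \<open>The constants are uniform over all nodes of all graphs of the family.\<close>
definition bounded_growth :: "(nat \<Rightarrow> real) \<Rightarrow> 'a pair_pre_digraph set \<Rightarrow> bool" where
  "bounded_growth f \<G> \<longleftrightarrow>
     (\<exists>c\<^sub>1>0. \<exists>c\<^sub>2>0. \<forall>G\<in>\<G>. \<forall>v\<in>pverts G. bounded_growth_at f c\<^sub>1 c\<^sub>2 G v)"

text \<open>\<open>f(k) = 2\<^bsup>o(k)\<^esup>\<close>, read as an asymptotic upper bound.\<close>
definition subexponential :: "(nat \<Rightarrow> real) \<Rightarrow> bool" where
  "subexponential f \<longleftrightarrow>
     (\<exists>g :: nat \<Rightarrow> real. g \<in> o(\<lambda>k. real k) \<and> (\<forall>\<^sub>F k in sequentially. f k \<le> 2 powr g k))"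

definition configurations :: "'a pair_pre_digraph \<Rightarrow> ('a \<Rightarrow> real) set" where
  "configurations G = (pverts G \<rightarrow> {0, 1})"

definition majority_step :: "'a pair_pre_digraph \<Rightarrow> ('a \<Rightarrow> real) \<Rightarrow> 'a \<Rightarrow> real" where
  "majority_step G x u =
     (if (\<Sum>v\<in>neighbors G u. x v) > real (degree_of G u) / 2 then 1
      else if (\<Sum>v\<in>neighbors G u. x v) = real (degree_of G u) / 2 then x u
      else 0)"

definition orbit :: "'a pair_pre_digraph \<Rightarrow> ('a \<Rightarrow> real) \<Rightarrow> nat \<Rightarrow> 'a \<Rightarrow> real" where
  "orbit G x t = (majority_step G ^^ t) x"

text \<open>\<open>c\<^sub>r\<^sup>t(x)\<close>, meant for \<open>t \<ge> 1\<close>.\<close>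
definition two_step_change :: "'a pair_pre_digraph \<Rightarrow> ('a \<Rightarrow> real) \<Rightarrow> 'a \<Rightarrow> nat \<Rightarrow> real" where
  "two_step_change G x r t = \<bar>orbit G x (t + 1) r - orbit G x (t - 1) r\<bar>"

definition degree_exponent :: "nat \<Rightarrow> real" where
  "degree_exponent \<Delta> = log 2 (real \<Delta> + 2) / log 2 (real \<Delta>) - 1"

end

theory Submission
  imports Defs
begin

text \<open>
  Pass to spins \<open>y = 2x - 1\<close>. For edge weights \<open>w\<close> that are symmetric, the energy
  \<open>F t = \<Sum>\<^sub>u \<Sum>\<^sub>v w u v * y (t + 1) u * y t v\<close> changes in one step by
  \<open>\<Sum>\<^sub>u (y (t + 2) u - y t u) * (\<Sum>\<^sub>v w u v * y (t + 1) v)\<close>.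
  Weight an edge by \<open>\<rho>\<^bsup>k\<^esup>\<close>, where \<open>k\<close> is the smaller distance of its ends from \<open>r\<close> and
  \<open>\<rho> = D / (D + 2)\<close>. The weights at a node differ by a factor of at most \<open>1 / \<rho>\<close>, which is too
  little for a minority of the at most \<open>D + 1\<close> neighbors to outweigh the majority. So every
  summand is nonnegative, and each two-step change at \<open>r\<close> costs a constant amount of energy.
  The number of changes is therefore of the order of \<open>\<Sum>\<^sub>u \<rho>\<^bsup>d(r,u)\<^esup>\<close>, which is estimated
  through the sphere sizes: by a convergent series in the sub-exponential case, and otherwise by
  cutting at the radius where a tree of that degree would have exhausted all \<open>n\<close> nodes.
\<close>

section \<open>Weighted energy of a symmetric sign dynamics\<close>

text \<open>Strictness and the cap \<open>D + 1\<close> leave at most \<open>D / 2\<close>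
  dissenters, outnumbered by at least one. The ratio of dissenters to supporters is thus at most
  \<open>D / (D + 2)\<close>, just what the permitted spread of the weights can make up for.\<close>

lemma weighted_majority:
  fixes y w :: "'a \<Rightarrow> real" and \<sigma> p :: real and D :: nat
  assumes fin: "finite N" and y: "\<And>v. v \<in> N \<Longrightarrow> y v \<in> {-1, 1}" and \<sigma>: "\<sigma> \<in> {-1, 1}"
    and maj: "\<sigma> * (\<Sum>v\<in>N. y v) > 0" and card: "card N \<le> D + 1" and D: "D \<ge> 1"
    and p: "p \<ge> 0" and w_ge: "\<And>v. v \<in> N \<Longrightarrow> p \<le> w v"
    and w_le: "\<And>v. v \<in> N \<Longrightarrow> w v * (real D / (real D + 2)) \<le> p"
  shows "\<sigma> * (\<Sum>v\<in>N. w v * y v) \<ge> 0"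
proof -
  define S where "S = {v \<in> N. y v = \<sigma>}"
  define S' where "S' = N - S"
  have N: "N = S \<union> S'" "S \<inter> S' = {}" and finS: "finite S" "finite S'"
    using fin by (auto simp: S_def S'_def)
  have flip: "\<sigma> * y v = (if v \<in> S then 1 else - 1)" if "v \<in> N" for v
    using y[OF that] that \<sigma> by (auto simp: S_def)
  \<comment> \<open>Used twice: with constant weight 1 it turns the majority into a count, with
    \<open>w\<close> it is the goal.\<close>
  have split: "\<sigma> * (\<Sum>v\<in>N. g v * y v) = sum g S - sum g S'" for g :: "'a \<Rightarrow> real"
  proof -
    have "\<sigma> * (\<Sum>v\<in>N. g v * y v) = (\<Sum>v\<in>N. g v * (\<sigma> * y v))"
      by (simp add: sum_distrib_left mult_ac)
    also have "\<dots> = (\<Sum>v\<in>N. if v \<in> S then g v else - g v)"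
      by (intro sum.cong) (simp_all add: flip)
    also have "\<dots> = (\<Sum>v\<in>S. if v \<in> S then g v else - g v) + (\<Sum>v\<in>S'. if v \<in> S then g v else - g v)"
      unfolding N(1) by (rule sum.union_disjoint[OF finS N(2)])
    also have "(\<Sum>v\<in>S'. if v \<in> S then g v else - g v) = (\<Sum>v\<in>S'. - g v)"
      by (intro sum.cong) (simp_all add: S'_def)
    finally show ?thesis by (simp add: sum_negf)
  qed
  have "card S' < card S"
    using maj split[of "\<lambda>_. 1"] by simp
  moreover have "card S + card S' \<le> D + 1"
    using card card_Un_disjoint[OF finS N(2)] N(1) by simp
  ultimately have "real (card S') * 2 \<le> real D" "real D * (real (card S') + 1) \<le> real D * real (card S)"
    by (auto intro!: mult_left_mono)
  hence "real (card S') * (real D + 2) \<le> real D * real (card S)"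
    by (simp add: algebra_simps)
  hence "(real (card S') * p) * (real D + 2) \<le> (real D * real (card S)) * p"
    using p by (metis mult.assoc mult.commute mult_right_mono)
  moreover have "sum w S' * (real D / (real D + 2)) \<le> real (card S') * p"
    unfolding sum_distrib_right using sum_mono[of S' _ "\<lambda>_. p"] w_le by (simp add: S'_def)
  hence "sum w S' * real D \<le> (real (card S') * p) * (real D + 2)"
    by (simp add: field_simps)
  ultimately have "real D * sum w S' \<le> real D * (real (card S) * p)"
    by (simp add: mult_ac)
  hence "sum w S' \<le> real (card S) * p"
    using D by simp
  also have "\<dots> \<le> sum w S"
    using sum_mono[of S "\<lambda>_. p" w] w_ge by (simp add: S_def)
  finally show ?thesis
    unfolding split by simp
qed

text \<open>The increments of \<open>F\<close> dominate the changes at \<open>r\<close> and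
  telescope, while \<open>F\<close> stays bounded. \<open>N u\<close> may contain \<open>u\<close>,
  and of distance only \<open>l r = 0\<close> and the Lipschitz bound enter.\<close>

lemma sum_two_step_change_le_weights:
  fixes y :: "nat \<Rightarrow> 'a \<Rightarrow> real" and N :: "'a \<Rightarrow> 'a set" and l :: "'a \<Rightarrow> nat" and D :: nat
  assumes fin: "finite V" and N_sub: "\<And>u. u \<in> V \<Longrightarrow> N u \<subseteq> V"
    and sym: "\<And>u v. u \<in> V \<Longrightarrow> v \<in> V \<Longrightarrow> v \<in> N u \<longleftrightarrow> u \<in> N v"
    and y: "\<And>t u. u \<in> V \<Longrightarrow> y t u \<in> {-1, 1}"
    and maj: "\<And>t u. u \<in> V \<Longrightarrow> y (Suc t) u * (\<Sum>v\<in>N u. y t v) > 0"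
    and card: "\<And>u. u \<in> V \<Longrightarrow> card (N u) \<le> D + 1" and D: "D \<ge> 1"
    and lip: "\<And>u v. u \<in> V \<Longrightarrow> v \<in> N u \<Longrightarrow> l u \<le> l v + 1"
    and r: "r \<in> V" "l r = 0"
  shows "(\<Sum>t<T. \<bar>y (t + 2) r - y t r\<bar>)
    \<le> 2 * ((real D + 1) * ((real D + 2) / real D) * (\<Sum>u\<in>V. (real D / (real D + 2)) ^ l u))"
proof -
  define \<rho> where "\<rho> = real D / (real D + 2)"
  have \<rho>: "0 < \<rho>" "\<rho> \<le> 1" "1 / \<rho> = (real D + 2) / real D"
    using D by (auto simp: \<rho>_def)
  \<comment> \<open>The minimum makes the weight symmetric; for a neighbor \<open>v\<close> of
    \<open>u\<close> it is \<open>\<rho> ^ l u\<close> or \<open>\<rho> ^ (l u - 1)\<close>.\<close>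
  define w where "w u v = \<rho> ^ min (l u) (l v)" for u v
  define h where "h t u = (\<Sum>v\<in>N u. w u v * y t v)" for t u
  define F where "F t = (\<Sum>u\<in>V. y (Suc t) u * h t u)" for t
  have w_sym: "w u v = w v u" for u v
    by (simp add: w_def min.commute)
  have finN: "finite (N u)" if "u \<in> V" for u
    using finite_subset[OF N_sub fin] that .
  have w_pos: "w u v > 0" for u v
    using \<rho> by (simp add: w_def)
  have w_ge: "\<rho> ^ l u \<le> w u v" for u v
    unfolding w_def using \<rho> by (intro power_decreasing) auto
  have w_le: "w u v * \<rho> \<le> \<rho> ^ l u" if "u \<in> V" "v \<in> N u" for u v
    unfolding w_def power_Suc2[symmetric] using \<rho> lip[OF that] by (intro power_decreasing) auto
  have h_nonneg: "y (Suc t) u * h t u \<ge> 0" if "u \<in> V" for t u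
    unfolding h_def
    by (rule weighted_majority[OF finN[OF that] _ y[OF that] maj[OF that] card[OF that] D, where p = "\<rho> ^ l u"])
       (use \<rho> w_ge w_le[OF that] y[OF subsetD[OF N_sub[OF that]]] in \<open>simp_all add: \<rho>_def[symmetric]\<close>)
  \<comment> \<open>All weights at \<open>r\<close> are 1, so the product is a positive
    integer.\<close>
  have h_r: "y (Suc t) r * h t r \<ge> 1" for t
  proof -
    have "h t r = (\<Sum>v\<in>N r. y t v)"
      using r by (simp add: h_def w_def)
    moreover have "\<exists>k :: int. a = of_int k" if "a \<in> {-1, 1}" for a :: real
      using that by (metis insertE empty_iff of_int_1 of_int_minus)
    hence ints: "y t v \<in> \<int>" if "v \<in> V" for t v
      using y[OF that] unfolding Ints_def by blast
    have "y (Suc t) r * (\<Sum>v\<in>N r. y t v) \<in> \<int>"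
      using r N_sub by (intro Ints_mult Ints_sum ints) auto
    ultimately show ?thesis
      using maj[OF r(1), of t] by (auto simp: Ints_def)
  qed
  \<comment> \<open>Symmetry moves the weighted sum from time \<open>t\<close> to time
    \<open>t + 1\<close>, so that consecutive energies share the factor
    \<open>h (Suc t) u\<close>.\<close>
  have swap: "F t = (\<Sum>u\<in>V. y t u * h (Suc t) u)" for t
  proof -
    have restr: "N u = {v \<in> V. v \<in> N u}" if "u \<in> V" for u
      using N_sub that by auto
    have "F t = (\<Sum>u\<in>V. \<Sum>v\<in>{v \<in> V. v \<in> N u}. y (Suc t) u * (w u v * y t v))"
      unfolding F_def h_def sum_distrib_left
      by (intro sum.cong) (use restr in auto)
    also have "\<dots> = (\<Sum>v\<in>V. \<Sum>u\<in>{u \<in> V. v \<in> N u}. y (Suc t) u * (w u v * y t v))"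
      by (rule sum.swap_restrict[OF fin fin])
    also have "\<dots> = (\<Sum>v\<in>V. \<Sum>u\<in>N v. y t v * (w v u * y (Suc t) u))"
    proof (intro sum.cong refl)
      fix v assume "v \<in> V"
      thus "{u \<in> V. v \<in> N u} = N v"
        using sym N_sub by blast
    qed (use w_sym in \<open>simp add: mult_ac\<close>)
    finally show ?thesis
      by (simp add: h_def sum_distrib_left)
  qed
  have step: "\<bar>y (t + 2) r - y t r\<bar> \<le> F (Suc t) - F t" for t
  proof -
    have diff: "F (Suc t) - F t = (\<Sum>u\<in>V. (y (t + 2) u - y t u) * h (Suc t) u)"
      by (subst swap[of t]) (simp add: F_def sum_subtractf left_diff_distrib)
    \<comment> \<open>The difference is 0 or \<open>2 * y (t + 2) u\<close>, so
      \<open>h_nonneg\<close> at time \<open>t + 1\<close> gives the sign.\<close>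
    have nn: "(y (t + 2) u - y t u) * h (Suc t) u \<ge> 0" if "u \<in> V" for u
      using y[OF that, of "t + 2"] y[OF that, of t] h_nonneg[OF that, of "Suc t"] by auto
    have "\<bar>y (t + 2) r - y t r\<bar> \<le> (y (t + 2) r - y t r) * h (Suc t) r"
      using y[OF r(1), of "t + 2"] y[OF r(1), of t] h_r[of "Suc t"] by auto
    also have "\<dots> \<le> F (Suc t) - F t"
      unfolding diff by (rule member_le_sum) (use r fin nn in auto)
    finally show ?thesis .
  qed
  have abs_y: "\<bar>y t u\<bar> = 1" if "u \<in> V" for t u
    using y[OF that, of t] by auto
  have bound: "\<bar>F t\<bar> \<le> (real D + 1) * (1 / \<rho>) * (\<Sum>u\<in>V. \<rho> ^ l u)" for t
  proof -
    have "\<bar>y (Suc t) u * h t u\<bar> \<le> (real D + 1) * (1 / \<rho>) * \<rho> ^ l u" if u: "u \<in> V" for u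
    proof -
      have "\<bar>y (Suc t) u * h t u\<bar> = \<bar>h t u\<bar>"
        using abs_y[OF u] by (simp add: abs_mult)
      also have "\<dots> \<le> (\<Sum>v\<in>N u. \<bar>w u v * y t v\<bar>)"
        unfolding h_def by (rule sum_abs)
      also have "\<dots> \<le> (\<Sum>v\<in>N u. \<rho> ^ l u / \<rho>)"
      proof (rule sum_mono)
        fix v assume v: "v \<in> N u"
        hence "\<bar>w u v * y t v\<bar> = w u v"
          using abs_y N_sub[OF u] w_pos[of u v] by (auto simp: abs_mult)
        thus "\<bar>w u v * y t v\<bar> \<le> \<rho> ^ l u / \<rho>"
          using w_le[OF u v] \<rho> by (simp add: field_simps)
      qed
      also have "\<dots> = real (card (N u)) * (\<rho> ^ l u / \<rho>)"
        by simp
      also have "\<dots> \<le> (real D + 1) * (\<rho> ^ l u / \<rho>)"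
        using card[OF u] \<rho> by (intro mult_right_mono) auto
      finally show ?thesis by simp
    qed
    hence "(\<Sum>u\<in>V. \<bar>y (Suc t) u * h t u\<bar>) \<le> (\<Sum>u\<in>V. (real D + 1) * (1 / \<rho>) * \<rho> ^ l u)"
      by (rule sum_mono)
    hence "\<bar>F t\<bar> \<le> (\<Sum>u\<in>V. (real D + 1) * (1 / \<rho>) * \<rho> ^ l u)"
      unfolding F_def by (rule order_trans[OF sum_abs])
    thus ?thesis
      by (simp only: sum_distrib_left[symmetric])
  qed
  have "(\<Sum>t<T. \<bar>y (t + 2) r - y t r\<bar>) \<le> (\<Sum>t<T. F (Suc t) - F t)"
    by (rule sum_mono) (rule step)
  also have "\<dots> = F T - F 0"
    by (rule sum_lessThan_telescope)
  also have "\<dots> \<le> 2 * ((real D + 1) * (1 / \<rho>) * (\<Sum>u\<in>V. \<rho> ^ l u))"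
    using bound[of T] bound[of 0] by linarith
  finally show ?thesis
    unfolding \<rho>(3) unfolding \<rho>_def .
qed

section \<open>Distance levels\<close>

text \<open>Lets relation powers replace walks. The vertex condition matters at
  \<open>n = 0\<close>, where the power is the identity on the whole type.\<close>

lemma awalk_length_iff_relpow:
  assumes "wf_digraph (with_proj G)"
  shows "(\<exists>p. pre_digraph.awalk (with_proj G) u p v \<and> length p = n)
    \<longleftrightarrow> u \<in> pverts G \<and> (u, v) \<in> parcs G ^^ n"
proof -
  interpret wf_digraph "with_proj G" by fact
  have wf: "a \<in> pverts G" "b \<in> pverts G" if "(a, b) \<in> parcs G" for a b
    using wellformed[of "(a, b)"] that by simp_all
  show ?thesis
  proof (induction n arbitrary: u)
    case 0
    show ?case by (auto simp: awalk_Nil_iff)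
  next
    case (Suc n)
    have "(\<exists>p. awalk u p v \<and> length p = Suc n)
      \<longleftrightarrow> (\<exists>x p. (u, x) \<in> parcs G \<and> awalk x p v \<and> length p = n)"
    proof
      assume "\<exists>p. awalk u p v \<and> length p = Suc n"
      then obtain e p where "awalk u (e # p) v" "length p = n"
        by (auto simp: length_Suc_conv)
      moreover from this have "(u, snd e) \<in> parcs G" "awalk (snd e) p v"
        by (cases e; simp add: awalk_Cons_iff)+
      ultimately show "\<exists>x p. (u, x) \<in> parcs G \<and> awalk x p v \<and> length p = n"
        by blast
    next
      assume "\<exists>x p. (u, x) \<in> parcs G \<and> awalk x p v \<and> length p = n"
      then obtain x p where "(u, x) \<in> parcs G" "awalk x p v" "length p = n"
        by blast
      hence "awalk u ((u, x) # p) v" "length ((u, x) # p) = Suc n"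
        by (simp_all add: awalk_Cons_iff)
      thus "\<exists>p. awalk u p v \<and> length p = Suc n"
        by blast
    qed
    also have "\<dots> \<longleftrightarrow> (\<exists>x. (u, x) \<in> parcs G \<and> x \<in> pverts G \<and> (x, v) \<in> parcs G ^^ n)"
      using Suc by blast
    also have "\<dots> \<longleftrightarrow> u \<in> pverts G \<and> (u, v) \<in> parcs G ^^ Suc n"
      using wf by (metis relpow_Suc_I2 relpow_Suc_D2)
    finally show ?case .
  qed
qed

lemma mem_graph_ball_iff:
  assumes "wf_digraph (with_proj G)" and r: "r \<in> pverts G"
  shows "u \<in> graph_ball G r k \<longleftrightarrow> u \<in> pverts G \<and> (\<exists>j\<le>k. (r, u) \<in> parcs G ^^ j)"
proof -
  interpret wf_digraph "with_proj G" by fact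
  have cost: "awalk_cost (\<lambda>_. 1) p = real (length p)" for p :: "('a \<times> 'a) list"
    by (induction p) auto
  have "\<mu> (\<lambda>_. 1) r u \<le> ereal (real k) \<longleftrightarrow> (\<exists>p. awalk r p u \<and> length p \<le> k)"
  proof
    assume "\<exists>p. awalk r p u \<and> length p \<le> k"
    then obtain p where p: "awalk r p u" "length p \<le> k" by blast
    have "\<mu> (\<lambda>_. 1) r u \<le> ereal (real (length p))"
      using min_cost_le_walk_cost[OF p(1), of "\<lambda>_. 1"] by (simp add: cost)
    also have "\<dots> \<le> ereal (real k)" using p by simp
    finally show "\<mu> (\<lambda>_. 1) r u \<le> ereal (real k)" .
  next
    assume le: "\<mu> (\<lambda>_. 1) r u \<le> ereal (real k)"
    show "\<exists>p. awalk r p u \<and> length p \<le> k"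
    proof (rule ccontr)
      assume "\<not> ?thesis"
      \<comment> \<open>Lengths are integers, so without a walk of length at most \<open>k\<close>
        the infimum is at least \<open>k + 1\<close>; it is infinite if there is no walk at
        all.\<close>
      hence "ereal (real (Suc k)) \<le> \<mu> (\<lambda>_. 1) r u"
        unfolding \<mu>_def by (intro INF_greatest) (auto simp: cost not_le)
      with le have "ereal (real (Suc k)) \<le> ereal (real k)" by (rule order_trans[rotated])
      thus False by simp
    qed
  qed
  also have "\<dots> \<longleftrightarrow> (\<exists>j\<le>k. \<exists>p. awalk r p u \<and> length p = j)"
    by auto
  also have "\<dots> \<longleftrightarrow> (\<exists>j\<le>k. (r, u) \<in> parcs G ^^ j)"
    using r by (simp add: awalk_length_iff_relpow[OF assms(1)])
  finally show ?thesis
    by (auto simp: graph_ball_def graph_dist_def)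
qed

text \<open>The distance from \<open>r\<close> as a natural number; connectedness makes the
  \<open>LEAST\<close> meaningful for any two nodes.\<close>

definition level :: "'a pair_pre_digraph \<Rightarrow> 'a \<Rightarrow> 'a \<Rightarrow> nat" where
  "level G r u = (LEAST k. (r, u) \<in> parcs G ^^ k)"

text \<open>Unlike \<open>graph_sphere\<close>, this is the right set at radius 0 too, so the level
  sets partition the nodes.\<close>

definition level_set :: "'a pair_pre_digraph \<Rightarrow> 'a \<Rightarrow> nat \<Rightarrow> 'a set" where
  "level_set G r k = {u \<in> pverts G. level G r u = k}"

locale finite_connected_graph =
  fixes G :: "'a pair_pre_digraph"
  assumes connected: "connected_graph G"
begin

lemma is_pair_graph: "pair_graph G"
  using connected by (simp add: connected_graph_def)

lemma is_wf: "wf_digraph (with_proj G)"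
proof -
  interpret pair_graph G by (rule is_pair_graph)
  show ?thesis by unfold_locales
qed

lemma finite_verts: "finite (pverts G)"
proof -
  interpret pair_graph G by (rule is_pair_graph)
  show ?thesis by (rule pair_finite_verts)
qed

lemma neighbors_sym: "v \<in> neighbors G u \<longleftrightarrow> u \<in> neighbors G v"
proof -
  interpret pair_graph G by (rule is_pair_graph)
  show ?thesis by (auto simp: neighbors_def intro: arcs_symmetric)
qed

lemma not_self_neighbor: "u \<notin> neighbors G u"
proof -
  interpret pair_graph G by (rule is_pair_graph)
  show ?thesis by (auto simp: neighbors_def dest: no_loops')
qed

lemma neighbors_subset: "neighbors G u \<subseteq> pverts G"
proof -
  interpret pair_graph G by (rule is_pair_graph)
  show ?thesis by (auto simp: neighbors_def dest: in_arcsD2)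
qed

lemma finite_neighbors: "finite (neighbors G u)"
  using neighbors_subset finite_verts by (rule finite_subset)

lemma card_pos: "0 < card (pverts G)"
  using connected finite_verts
  by (auto simp: connected_graph_def Digraph_Component.connected_def strongly_connected_def card_gt_0_iff)

lemma relpow_connected:
  assumes "r \<in> pverts G" "u \<in> pverts G"
  shows "\<exists>k. (r, u) \<in> parcs G ^^ k"
proof -
  interpret pair_graph G by (rule is_pair_graph)
  have "r \<rightarrow>\<^sup>*\<^bsub>with_proj (mk_symmetric (with_proj G))\<^esub> u"
    using connected assms
    by (auto simp: connected_graph_def Digraph_Component.connected_def strongly_connected_def)
  \<comment> \<open>Connectedness is defined through the symmetric closure, which adds nothing to
    symmetric arcs.\<close>
  moreover have "parcs (mk_symmetric (with_proj G)) = parcs G"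
    by (auto simp: parcs_mk_symmetric intro: arcs_symmetric)
  ultimately have "(r, u) \<in> (parcs G)\<^sup>*"
    by (auto simp: reachable_def dest: rtrancl_on_rtranclI)
  thus ?thesis by (simp add: rtrancl_power)
qed

lemma relpow_level:
  assumes "r \<in> pverts G" "u \<in> pverts G"
  shows "(r, u) \<in> parcs G ^^ level G r u"
  unfolding level_def using relpow_connected[OF assms] by (rule LeastI_ex)

lemma level_le: "(r, u) \<in> parcs G ^^ k \<Longrightarrow> level G r u \<le> k"
  unfolding level_def by (rule Least_le)

lemma level_self: "level G r r = 0"
  using level_le[of r r 0] by simp

lemma level_neighbor:
  assumes "r \<in> pverts G" "u \<in> pverts G" "v \<in> neighbors G u"
  shows "level G r u \<le> level G r v + 1"
proof -
  have "(v, u) \<in> parcs G" "v \<in> pverts G"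
    using assms neighbors_sym neighbors_subset by (auto simp: neighbors_def)
  hence "(r, u) \<in> parcs G ^^ Suc (level G r v)"
    using relpow_level[of r v] assms by (auto intro: relpow_Suc_I)
  thus ?thesis using level_le by fastforce
qed

text \<open>\<open>v\<close> is the last node before \<open>u\<close> on a shortest walk; by the
  Lipschitz bound its level cannot be below \<open>k\<close>.\<close>

lemma level_parent:
  assumes "r \<in> pverts G" "u \<in> pverts G" "level G r u = Suc k"
  obtains v where "v \<in> level_set G r k" "u \<in> neighbors G v"
proof -
  obtain v where v: "(r, v) \<in> parcs G ^^ k" "u \<in> neighbors G v"
    using relpow_level[OF assms(1,2)] assms(3) by (auto simp: neighbors_def elim: relpow_Suc_E)
  have "v \<in> pverts G"
    using v neighbors_sym neighbors_subset by blast
  moreover have "level G r v = k"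
    using level_le[OF v(1)] level_neighbor[OF assms(1,2), of v] v(2) assms(3) neighbors_sym by simp
  ultimately show thesis
    using v(2) by (intro that[of v]) (simp_all add: level_set_def)
qed

lemma level_set_0: "r \<in> pverts G \<Longrightarrow> level_set G r 0 = {r}"
  using relpow_level[of r] by (force simp: level_set_def level_self)

lemma graph_ball_eq_level:
  assumes "r \<in> pverts G"
  shows "graph_ball G r k = {u \<in> pverts G. level G r u \<le> k}"
  using mem_graph_ball_iff[OF is_wf assms] relpow_level[OF assms]
  by (auto intro: order_trans[OF level_le])

lemma graph_sphere_eq_level_set:
  assumes "r \<in> pverts G" "k > 0"
  shows "graph_sphere G r k = level_set G r k"
  using assms by (auto simp: graph_sphere_def graph_ball_eq_level level_set_def)

lemma level_set_1:
  assumes "r \<in> pverts G"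
  shows "level_set G r 1 = neighbors G r"
proof (rule set_eqI, rule iffI)
  fix u assume "u \<in> level_set G r 1"
  then obtain v where "v \<in> level_set G r 0" "u \<in> neighbors G v"
    using level_parent[OF assms, of u 0] unfolding level_set_def One_nat_def by blast
  thus "u \<in> neighbors G r"
    using level_set_0[OF assms] by simp
next
  fix u assume u: "u \<in> neighbors G r"
  hence "u \<in> pverts G" "u \<noteq> r"
    using neighbors_subset not_self_neighbor by auto
  moreover have "level G r u \<noteq> 0"
  proof
    assume "level G r u = 0"
    hence "u \<in> level_set G r 0"
      using \<open>u \<in> pverts G\<close> by (simp add: level_set_def)
    thus False
      using level_set_0[OF assms] \<open>u \<noteq> r\<close> by simp
  qed
  moreover have "level G r u \<le> 1"
    using level_neighbor[OF assms, of u r] u \<open>u \<in> pverts G\<close> neighbors_sym by (simp add: level_self)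
  ultimately show "u \<in> level_set G r 1"
    by (simp add: level_set_def)
qed

section \<open>Sphere sizes and sums over levels\<close>

lemma finite_level_set: "finite (level_set G r k)"
  using finite_verts by (simp add: level_set_def)

text \<open>Comparison with a tree: every node other than \<open>r\<close> spends one neighbor on
  its parent, leaving at most \<open>\<Delta> - 1\<close> for the next level.\<close>

lemma card_level_set_le:
  assumes r: "r \<in> pverts G" and deg: "\<And>u. u \<in> pverts G \<Longrightarrow> degree_of G u \<le> \<Delta>"
  shows "card (level_set G r (Suc k)) \<le> \<Delta> * (\<Delta> - 1) ^ k"
proof (induction k)
  case 0
  show ?case
    using deg[OF r] level_set_1[OF r] by (simp add: degree_of_def)
next
  case (Suc k)
  let ?C = "\<lambda>v. neighbors G v \<inter> level_set G r (Suc (Suc k))"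
  have children: "card (?C v) \<le> \<Delta> - 1" if "v \<in> level_set G r (Suc k)" for v
  proof -
    have "v \<in> pverts G" "level G r v = Suc k"
      using that by (simp_all add: level_set_def)
    then obtain p where p: "p \<in> level_set G r k" "v \<in> neighbors G p"
      by (rule level_parent[OF r])
    \<comment> \<open>The parent \<open>p\<close> is at level \<open>k\<close>, hence not among the
      neighbors at level \<open>k + 2\<close>.\<close>
    have "card (?C v) \<le> card (neighbors G v - {p})"
      using p finite_neighbors by (intro card_mono) (auto simp: level_set_def)
    also have "\<dots> = degree_of G v - 1"
      using p neighbors_sym finite_neighbors by (simp add: degree_of_def)
    also have "\<dots> \<le> \<Delta> - 1"
      using deg[of v] that by (auto simp: level_set_def intro: diff_le_mono)
    finally show ?thesis .
  qed
  have "level_set G r (Suc (Suc k)) \<subseteq> (\<Union>v\<in>level_set G r (Suc k). ?C v)"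
  proof
    fix u assume u: "u \<in> level_set G r (Suc (Suc k))"
    then obtain v where "v \<in> level_set G r (Suc k)" "u \<in> neighbors G v"
      using level_parent[OF r, of u "Suc k"] unfolding level_set_def by blast
    with u show "u \<in> (\<Union>v\<in>level_set G r (Suc k). ?C v)" by blast
  qed
  hence "card (level_set G r (Suc (Suc k))) \<le> card (\<Union>v\<in>level_set G r (Suc k). ?C v)"
    using finite_level_set by (intro card_mono) auto
  also have "\<dots> \<le> (\<Sum>v\<in>level_set G r (Suc k). card (?C v))"
    using finite_level_set by (rule card_UN_le)
  also have "\<dots> \<le> card (level_set G r (Suc k)) * (\<Delta> - 1)"
    using sum_bounded_above[of "level_set G r (Suc k)" "\<lambda>v. card (?C v)" "\<Delta> - 1"] children by simp
  also have "\<dots> \<le> \<Delta> * (\<Delta> - 1) ^ k * (\<Delta> - 1)"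
    using Suc by (intro mult_right_mono) auto
  finally show ?case by (simp add: mult_ac)
qed

text \<open>\<open>P\<close> allows both uses: always true, with \<open>K\<close> beyond all levels,
  and the cut-off \<open>level G r u < K\<close> itself.\<close>

lemma sum_by_level:
  fixes g :: "nat \<Rightarrow> real"
  assumes "\<And>u. u \<in> pverts G \<Longrightarrow> P u \<longleftrightarrow> level G r u < K"
  shows "(\<Sum>u | u \<in> pverts G \<and> P u. g (level G r u)) = (\<Sum>k<K. real (card (level_set G r k)) * g k)"
proof -
  let ?A = "{u \<in> pverts G. P u}"
  have "(\<Sum>u\<in>?A. g (level G r u)) = (\<Sum>k<K. \<Sum>u\<in>{u \<in> ?A. level G r u = k}. g (level G r u))"
    using finite_verts assms by (intro sum.group[symmetric]) auto
  also have "\<dots> = (\<Sum>k<K. real (card (level_set G r k)) * g k)"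
  proof (intro sum.cong refl)
    fix k assume "k \<in> {..<K}"
    hence "{u \<in> ?A. level G r u = k} = level_set G r k"
      using assms by (auto simp: level_set_def)
    thus "(\<Sum>u\<in>{u \<in> ?A. level G r u = k}. g (level G r u)) = real (card (level_set G r k)) * g k"
      by (simp add: level_set_def)
  qed
  finally show ?thesis by simp
qed

lemma obtain_levels:
  obtains K where "(\<Sum>u\<in>pverts G. g (level G r u)) = (\<Sum>k<K. real (card (level_set G r k)) * g k)"
proof -
  obtain K where "\<And>u. u \<in> pverts G \<Longrightarrow> level G r u < K"
    using finite_nat_set_iff_bounded[of "level G r ` pverts G"] finite_verts by auto
  thus thesis
    using sum_by_level[of "\<lambda>_. True" r K g] that[of K] by simp
qed

text \<open>Sphere bounds of tree type are useless once they exceed the number of nodes. From level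
  \<open>K\<close> on, every node is charged at most \<open>\<rho> ^ K\<close> instead, and their
  number is bounded by that of all nodes.\<close>

lemma sum_power_level_le:
  assumes "0 \<le> \<rho>" "\<rho> \<le> (1 :: real)"
  shows "(\<Sum>u\<in>pverts G. \<rho> ^ level G r u)
    \<le> (\<Sum>k<K. real (card (level_set G r k)) * \<rho> ^ k) + real (card (pverts G)) * \<rho> ^ K"
proof -
  let ?A = "{u \<in> pverts G. level G r u < K}" and ?B = "{u \<in> pverts G. \<not> level G r u < K}"
  have "(\<Sum>u\<in>pverts G. \<rho> ^ level G r u) = (\<Sum>u\<in>?A \<union> ?B. \<rho> ^ level G r u)"
    by (intro sum.cong) auto
  also have "\<dots> = (\<Sum>u\<in>?A. \<rho> ^ level G r u) + (\<Sum>u\<in>?B. \<rho> ^ level G r u)"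
    using finite_verts by (intro sum.union_disjoint) auto
  also have "(\<Sum>u\<in>?A. \<rho> ^ level G r u) = (\<Sum>k<K. real (card (level_set G r k)) * \<rho> ^ k)"
    by (rule sum_by_level) simp
  also have "(\<Sum>u\<in>?B. \<rho> ^ level G r u) \<le> (\<Sum>u\<in>?B. \<rho> ^ K)"
    using assms by (intro sum_mono power_decreasing) auto
  also have "\<dots> \<le> real (card (pverts G)) * \<rho> ^ K"
    using assms finite_verts by (auto intro!: mult_right_mono card_mono)
  finally show ?thesis by simp
qed

section \<open>Majority dynamics as a sign dynamics\<close>

text \<open>A loop at every node of even degree turns the tie-breaking rule into a strict majority.\<close>
definition loop_neighbors :: "'a \<Rightarrow> 'a set" where
  "loop_neighbors u = neighbors G u \<union> (if even (degree_of G u) then {u} else {})"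

lemma card_loop_neighbors:
  "card (loop_neighbors u) = (if even (degree_of G u) then degree_of G u + 1 else degree_of G u)"
  using not_self_neighbor finite_neighbors by (simp add: loop_neighbors_def degree_of_def)

lemma orbit_Suc: "orbit G x (Suc t) = majority_step G (orbit G x t)"
  by (simp add: orbit_def)

lemma orbit_01:
  assumes "x \<in> configurations G" "u \<in> pverts G"
  shows "orbit G x t u \<in> {0, 1}"
  using assms(2)
proof (induction t arbitrary: u)
  case 0
  then show ?case
    using assms(1) by (auto simp: orbit_def configurations_def)
next
  case (Suc t)
  then show ?case
    using Suc.IH[of u] by (simp add: orbit_Suc majority_step_def)
qed

text \<open>With \<open>s\<close> neighbors in state 1 and degree \<open>d\<close>, the spins of the
  neighbors sum to \<open>2 * s - d\<close>. This cannot vanish for odd \<open>d\<close>; for even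
  \<open>d\<close> the loop adds the node's own spin, which decides exactly the ties.\<close>

lemma orbit_strict_majority:
  assumes x: "x \<in> configurations G" and u: "u \<in> pverts G"
  shows "(2 * orbit G x (Suc t) u - 1) * (\<Sum>v\<in>loop_neighbors u. 2 * orbit G x t v - 1) > 0"
proof -
  define S where "S = {v \<in> neighbors G u. orbit G x t v = 1}"
  define s where "s = card S"
  let ?d = "degree_of G u"
  have "(\<Sum>v\<in>neighbors G u. orbit G x t v) = (\<Sum>v\<in>neighbors G u. if orbit G x t v = 1 then 1 else 0)"
    using orbit_01[OF x] neighbors_subset by (intro sum.cong) fastforce+
  also have "\<dots> = real s"
    using finite_neighbors by (simp add: s_def S_def sum.If_cases Int_def)
  finally have s: "(\<Sum>v\<in>neighbors G u. orbit G x t v) = real s" .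
  have "(\<Sum>v\<in>loop_neighbors u. 2 * orbit G x t v - 1)
    = (\<Sum>v\<in>neighbors G u. 2 * orbit G x t v - 1) + (if even ?d then 2 * orbit G x t u - 1 else 0)"
    using not_self_neighbor finite_neighbors by (simp add: loop_neighbors_def)
  also have "(\<Sum>v\<in>neighbors G u. 2 * orbit G x t v - 1) = 2 * real s - real ?d"
    by (simp add: sum_subtractf sum_distrib_left[symmetric] s degree_of_def)
  finally have sum: "(\<Sum>v\<in>loop_neighbors u. 2 * orbit G x t v - 1)
    = 2 * real s - real ?d + (if even ?d then 2 * orbit G x t u - 1 else 0)" .
  have xu: "orbit G x t u \<in> {0, 1}"
    by (rule orbit_01[OF x u])
  consider "2 * s > ?d" | "2 * s = ?d" | "2 * s < ?d" by linarith
  thus ?thesis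
  proof cases
    case 1
    \<comment> \<open>For even degree the surplus is at least 2, so the loop cannot overturn
      it.\<close>
    hence "even ?d \<Longrightarrow> 2 * s \<ge> ?d + 2" by presburger
    with 1 xu show ?thesis
      unfolding sum orbit_Suc majority_step_def s by auto
  next
    case 2
    moreover from this have "even ?d" by presburger
    ultimately show ?thesis
      using xu unfolding sum orbit_Suc majority_step_def s by auto
  next
    case 3
    hence "even ?d \<Longrightarrow> 2 * s + 2 \<le> ?d" by presburger
    with 3 xu show ?thesis
      unfolding sum orbit_Suc majority_step_def s by auto
  qed
qed

text \<open>\<open>D + 1\<close> bounds neighborhoods including the loop, so an odd maximum degree
  \<open>\<Delta> \<ge> 3\<close> permits \<open>D = \<Delta> - 1\<close>, an even one
  \<open>D = \<Delta>\<close>.\<close>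

lemma sum_two_step_change_le_levels:
  fixes D :: nat
  assumes x: "x \<in> configurations G" and r: "r \<in> pverts G"
    and card: "\<And>u. u \<in> pverts G \<Longrightarrow> card (loop_neighbors u) \<le> D + 1" and D: "D \<ge> 1"
  shows "(\<Sum>t=1..T. two_step_change G x r t)
    \<le> (real D + 1) * ((real D + 2) / real D) * (\<Sum>u\<in>pverts G. (real D / (real D + 2)) ^ level G r u)"
proof -
  define y where "y t u = 2 * orbit G x t u - 1" for t u
  have "(\<Sum>t<T. \<bar>y (t + 2) r - y t r\<bar>)
    \<le> 2 * ((real D + 1) * ((real D + 2) / real D) * (\<Sum>u\<in>pverts G. (real D / (real D + 2)) ^ level G r u))"
  proof (rule sum_two_step_change_le_weights[OF finite_verts _ _ _ _ card D _ r level_self])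
    show "loop_neighbors u \<subseteq> pverts G" if "u \<in> pverts G" for u
      using that neighbors_subset by (auto simp: loop_neighbors_def)
    show "v \<in> loop_neighbors u \<longleftrightarrow> u \<in> loop_neighbors v" for u v
      using neighbors_sym by (auto simp: loop_neighbors_def)
    show "y t u \<in> {-1, 1}" if "u \<in> pverts G" for t u
      using orbit_01[OF x that, of t] by (auto simp: y_def)
    show "0 < y (Suc t) u * sum (y t) (loop_neighbors u)" if "u \<in> pverts G" for t u
      using orbit_strict_majority[OF x that, of t] by (simp add: y_def)
    show "level G r u \<le> level G r v + 1" if "u \<in> pverts G" "v \<in> loop_neighbors u" for u v
      using that level_neighbor[OF r] by (auto simp: loop_neighbors_def split: if_splits)
  qed
  \<comment> \<open>Spins move twice as far as states, which cancels the factor 2 of the energy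
    bound.\<close>
  also have "(\<Sum>t<T. \<bar>y (t + 2) r - y t r\<bar>) = 2 * (\<Sum>t=1..T. two_step_change G x r t)"
  proof -
    have "(\<Sum>t=1..T. two_step_change G x r t) = (\<Sum>t<T. two_step_change G x r (Suc t))"
      by (simp add: sum.atLeast1_atMost_eq)
    moreover have "\<bar>y (t + 2) r - y t r\<bar> = 2 * two_step_change G x r (Suc t)" for t
      by (simp add: y_def two_step_change_def abs_if)
    ultimately show ?thesis by (simp add: sum_distrib_left)
  qed
  finally show ?thesis by simp
qed

lemma degree_le_max_degree: "u \<in> pverts G \<Longrightarrow> degree_of G u \<le> max_degree G"
  unfolding max_degree_def using finite_verts by (intro Max_ge) auto

lemma max_degree_le_card: "max_degree G \<le> card (pverts G)"
proof -
  have "degree_of G u \<le> card (pverts G)" for u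
    unfolding degree_of_def using neighbors_subset finite_verts by (rule card_mono[rotated])
  thus ?thesis
    unfolding max_degree_def using finite_verts card_pos
    by (intro Max.boundedI) (auto simp: card_gt_0_iff)
qed

end

section \<open>Weighted sums of sphere sizes\<close>

text \<open>Split \<open>\<rho> ^ k\<close> into \<open>q ^ k * q ^ k\<close>: one factor absorbs
  \<open>f\<close>, the other is summable. Sub-exponentiality bounds \<open>f\<close> only from
  above, hence the \<open>max\<close>.\<close>

lemma summable_subexponential:
  assumes f: "subexponential f" and \<rho>: "0 < \<rho>" "\<rho> < 1"
  shows "summable (\<lambda>k. max 0 (f k) * \<rho> ^ k)"
proof -
  define q where "q = sqrt \<rho>"
  have q: "0 < q" "q < 1" "\<rho> = q * q"
    using \<rho> by (auto simp: q_def)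
  \<comment> \<open>Chosen so that \<open>g k \<le> \<epsilon> * k\<close> yields
    \<open>f k \<le> (1 / q) ^ k\<close>.\<close>
  define \<epsilon> where "\<epsilon> = log 2 (1 / q)"
  have \<epsilon>: "\<epsilon> > 0" "2 powr \<epsilon> = 1 / q"
    using q by (auto simp: \<epsilon>_def)
  obtain g where g: "g \<in> o(\<lambda>k. real k)" and fg: "\<forall>\<^sub>F k in sequentially. f k \<le> 2 powr g k"
    using f unfolding subexponential_def by blast
  have "\<forall>\<^sub>F k in sequentially. norm (g k) \<le> \<epsilon> * norm (real k)"
    using g \<epsilon>(1) by (rule landau_o.smallD)
  with fg have "\<forall>\<^sub>F k in sequentially. norm (max 0 (f k) * \<rho> ^ k) \<le> q ^ k"
  proof eventually_elim
    case (elim k)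
    have "f k \<le> 2 powr (\<epsilon> * real k)"
      using elim by (intro order_trans[OF elim(1)] powr_mono) auto
    also have "\<dots> = (1 / q) ^ k"
      using q by (simp add: powr_powr[symmetric] \<epsilon>(2) powr_realpow)
    finally have "max 0 (f k) * \<rho> ^ k \<le> (1 / q) ^ k * \<rho> ^ k"
      using q by (intro mult_right_mono) auto
    also have "\<dots> = q ^ k"
      using q by (simp add: power_mult_distrib[symmetric])
    finally show ?case
      using \<rho> by simp
  qed
  thus ?thesis
    by (rule summable_comparison_test_ev) (use q in \<open>simp add: summable_geometric\<close>)
qed

text \<open>The numerator is \<open>- ln \<rho>\<close> for the decay rate
  \<open>\<rho> = \<Delta> / (\<Delta> + 2)\<close>, so that
  \<open>\<rho> = \<Delta> powr (- degree_exponent \<Delta>)\<close>.\<close>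

lemma degree_exponent_eq:
  assumes "\<Delta> \<ge> 2"
  shows "degree_exponent \<Delta> = ln (1 + 2 / real \<Delta>) / ln (real \<Delta>)"
proof -
  have "1 + 2 / real \<Delta> = (real \<Delta> + 2) / real \<Delta>"
    using assms by (simp add: field_simps)
  hence "ln (1 + 2 / real \<Delta>) = ln (real \<Delta> + 2) - ln (real \<Delta>)"
    using assms by (simp add: ln_div)
  moreover have "ln (real \<Delta>) > 0"
    using assms by simp
  ultimately show ?thesis
    by (simp add: degree_exponent_def log_def field_simps)
qed

text \<open>By \<open>ln z \<le> z - 1\<close> at \<open>z = 1 / (1 + 2 / \<Delta>)\<close>, the
  numerator of the exponent is at least \<open>2 / (\<Delta> + 2)\<close>, hence at least
  \<open>1 / \<Delta>\<close>. Strictness comes from \<open>ln 2 < 1\<close>.\<close>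

lemma degree_exponent_gt:
  assumes "\<Delta> \<ge> 2"
  shows "degree_exponent \<Delta> > 1 / (real \<Delta> * log 2 (real \<Delta>))"
proof -
  let ?d = "real \<Delta>"
  have ln_pos: "ln ?d > 0"
    using assms by simp
  have "ln 2 * (?d + 2) < 1 * (?d + 2)"
    using ln_2_less_1 by (intro mult_strict_right_mono) auto
  also have "\<dots> \<le> 2 * ?d"
    using assms by simp
  finally have "ln 2 / ?d < 2 / (?d + 2)"
    using assms by (simp add: field_simps)
  also have "\<dots> \<le> ln (1 + 2 / ?d)"
  proof -
    have "ln (inverse (1 + 2 / ?d)) \<le> inverse (1 + 2 / ?d) - 1"
      using assms by (intro ln_le_minus_one) (simp add: add_pos_nonneg)
    moreover have "inverse (1 + 2 / ?d) - 1 = - (2 / (?d + 2))"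
      using assms by (simp add: field_simps)
    moreover have "ln (inverse (1 + 2 / ?d)) = - ln (1 + 2 / ?d)"
      using assms by (simp add: ln_inverse add_pos_nonneg)
    ultimately show ?thesis by linarith
  qed
  finally have "ln 2 / ?d / ln ?d < ln (1 + 2 / ?d) / ln ?d"
    using ln_pos by (rule divide_strict_right_mono)
  thus ?thesis
    unfolding degree_exponent_eq[OF assms] by (simp add: log_def field_simps)
qed

lemma degree_exponent_2: "degree_exponent 2 = 1"
proof -
  have "log 2 (4 :: real) = 2"
    using log_pow_cancel[of 2 2] by simp
  thus ?thesis by (simp add: degree_exponent_def)
qed

section \<open>The bounds for the three classes of graphs\<close>

lemma bounded_growth_two_step_change:
  assumes f: "subexponential f" and conn: "\<And>G. G \<in> \<G> \<Longrightarrow> connected_graph G"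
    and growth: "bounded_growth f \<G>"
  shows "\<exists>C. \<forall>G\<in>\<G>. \<forall>x\<in>configurations G. \<forall>r\<in>pverts G. \<forall>T>0.
    (\<Sum>t=1..T. two_step_change G x r t) \<le> C"
proof -
  obtain c\<^sub>1 c\<^sub>2 where c: "c\<^sub>2 > 0"
      "\<And>G v. G \<in> \<G> \<Longrightarrow> v \<in> pverts G \<Longrightarrow> bounded_growth_at f c\<^sub>1 c\<^sub>2 G v"
    using growth unfolding bounded_growth_def by blast
  \<comment> \<open>The sphere of radius 1 is the neighborhood, so growth bounds all degrees in the
    family by \<open>c\<^sub>2 * f 1\<close>; the maximum ensures \<open>D \<ge> 1\<close>.\<close>
  define D where "D = nat \<lceil>max 1 (c\<^sub>2 * f 1)\<rceil>"
  define \<rho> where "\<rho> = real D / (real D + 2)"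
  have D_ge: "D \<ge> 1" "real D \<ge> c\<^sub>2 * f 1"
    unfolding D_def by linarith+
  have \<rho>: "0 < \<rho>" "\<rho> < 1"
    using D_ge(1) by (auto simp: \<rho>_def)
  define a where "a k = c\<^sub>2 * (max 0 (f k) * \<rho> ^ k)" for k
  have a: "summable a" "\<And>k. a k \<ge> 0"
    using summable_subexponential[OF f \<rho>] c(1) \<rho> unfolding a_def by (auto intro: summable_mult)
  show ?thesis
  proof (intro exI ballI allI impI)
    fix G x r and T :: nat
    assume G: "G \<in> \<G>" and x: "x \<in> configurations G" and r: "r \<in> pverts G"
    interpret finite_connected_graph G
      using conn[OF G] by unfold_locales
    have sphere: "real (card (level_set G v k)) \<le> c\<^sub>2 * f k"
      if "v \<in> pverts G" "k > 0" "level_set G v k \<noteq> {}" for v k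
      using c(2)[OF G that(1)] that graph_sphere_eq_level_set[OF that(1,2)]
      unfolding bounded_growth_at_def by metis
    have "degree_of G u \<le> D" if "u \<in> pverts G" for u
    \<comment> \<open>Without neighbors the sphere of radius 1 is empty and growth says nothing, but
      the degree is 0.\<close>
    proof (cases "neighbors G u = {}")
      case False
      hence "real (degree_of G u) \<le> c\<^sub>2 * f 1"
        using sphere[OF that, of 1] by (simp add: level_set_1[OF that] degree_of_def del: One_nat_def)
      with D_ge(2) show ?thesis by linarith
    qed (simp add: degree_of_def)
    hence card: "card (loop_neighbors u) \<le> D + 1" if "u \<in> pverts G" for u
      using that by (simp add: card_loop_neighbors le_SucI)
    obtain K where "(\<Sum>u\<in>pverts G. \<rho> ^ level G r u) = (\<Sum>k<K. real (card (level_set G r k)) * \<rho> ^ k)"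
      by (rule obtain_levels)
    \<comment> \<open>Growth speaks only of positive radii; level 0 is \<open>{r}\<close> and
      contributes 1.\<close>
    also have "\<dots> \<le> (\<Sum>k<K. (if k = 0 then 1 else 0) + a k)"
    proof (rule sum_mono)
      fix k
      show "real (card (level_set G r k)) * \<rho> ^ k \<le> (if k = 0 then 1 else 0) + a k"
      proof (cases "k = 0 \<or> level_set G r k = {}")
        case True
        thus ?thesis using level_set_0[OF r] a(2)[of k] by auto
      next
        case False
        hence "real (card (level_set G r k)) \<le> c\<^sub>2 * f k"
          using sphere[OF r] by simp
        also have "\<dots> \<le> c\<^sub>2 * max 0 (f k)"
          using c(1) by simp
        finally show ?thesis
          using False \<rho> mult_right_mono[of _ _ "\<rho> ^ k"] by (simp add: a_def mult_ac)
      qed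
    qed
    also have "\<dots> \<le> 1 + suminf a"
      unfolding sum.distrib using sum_le_suminf[OF a(1), of "{..<K}"] a(2)
      by (intro add_mono) (auto simp: sum.delta)
    finally have levels: "(\<Sum>u\<in>pverts G. \<rho> ^ level G r u) \<le> 1 + suminf a" .
    have "(\<Sum>t=1..T. two_step_change G x r t)
        \<le> (real D + 1) * ((real D + 2) / real D) * (\<Sum>u\<in>pverts G. \<rho> ^ level G r u)"
      unfolding \<rho>_def by (rule sum_two_step_change_le_levels[OF x r card D_ge(1)])
    also have "\<dots> \<le> (real D + 1) * ((real D + 2) / real D) * (1 + suminf a)"
      by (intro mult_left_mono levels) auto
    finally show "(\<Sum>t=1..T. two_step_change G x r t)
        \<le> (real D + 1) * ((real D + 2) / real D) * (1 + suminf a)" .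
  qed
qed

text \<open>Nodes of odd degree need no loop, so degree 3 already admits the weight ratio 1/2 of \<open>D = 2\<close>.\<close>
lemma degree_3_two_step_change:
  assumes "connected_graph G" and deg: "max_degree G = 3"
    and x: "x \<in> configurations G" and r: "r \<in> pverts G"
  shows "(\<Sum>t=1..T. two_step_change G x r t) \<le> 30 * log 2 (real (card (pverts G)))"
proof -
  interpret finite_connected_graph G
    using assms(1) by unfold_locales
  let ?n = "card (pverts G)"
  have deg3: "degree_of G u \<le> 3" if "u \<in> pverts G" for u
    using degree_le_max_degree[OF that] deg by simp
  have card: "card (loop_neighbors u) \<le> 2 + 1" if "u \<in> pverts G" for u
  proof -
    have "even (degree_of G u) \<Longrightarrow> degree_of G u \<le> 2"
      using deg3[OF that] by presburger
    thus ?thesis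
      using deg3[OF that] by (simp add: card_loop_neighbors)
  qed
  have n: "?n \<ge> 3"
    using max_degree_le_card deg by simp
  have log_ge: "log 2 (real ?n) \<ge> 1"
    using n by (simp add: le_log_iff)
  \<comment> \<open>From this radius on \<open>2 ^ K\<close> is at least the number of nodes, so the
    tail costs at most 1.\<close>
  define K where "K = nat \<lceil>log 2 (real ?n)\<rceil>"
  have K: "real K \<le> log 2 (real ?n) + 1" "log 2 (real ?n) \<le> real K"
    using log_ge unfolding K_def by linarith+
  have "real ?n \<le> 2 ^ K"
    using K(2) n by (simp add: log_le_iff powr_realpow)
  hence tail: "real ?n * (1 / 2) ^ K \<le> 1"
    by (simp add: power_divide)
  \<comment> \<open>The doubling of the spheres cancels the halving of the weights: each level costs
    1 or at most 3/2.\<close>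
  have "real (card (level_set G r k)) * (1 / 2) ^ k \<le> 2" for k
  proof (cases k)
    case 0
    thus ?thesis using level_set_0[OF r] by simp
  next
    case (Suc j)
    have "card (level_set G r k) \<le> 3 * 2 ^ j"
      using card_level_set_le[OF r deg3] unfolding Suc by simp
    hence "real (card (level_set G r k)) \<le> real (3 * 2 ^ j)"
      by (simp only: of_nat_le_iff)
    thus ?thesis by (simp add: Suc field_simps)
  qed
  hence "(\<Sum>k<K. real (card (level_set G r k)) * (1 / 2) ^ k) \<le> real K * 2"
    using sum_bounded_above[of "{..<K}" "\<lambda>k. real (card (level_set G r k)) * (1 / 2) ^ k" 2] by simp
  \<comment> \<open>\<open>2 * K + 1\<close> is at most \<open>2 * log 2 n + 3\<close>, and the 3 is
    absorbed by \<open>log 2 n \<ge> 1\<close>. The prefactor 6 of the energy bound then gives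
    30.\<close>
  hence levels: "(\<Sum>u\<in>pverts G. (1 / 2) ^ level G r u) \<le> 5 * log 2 (real ?n)"
    using sum_power_level_le[of "1 / 2" r K] tail K(1) log_ge by simp
  have "(\<Sum>t=1..T. two_step_change G x r t)
      \<le> (real 2 + 1) * ((real 2 + 2) / real 2) * (\<Sum>u\<in>pverts G. (real 2 / (real 2 + 2)) ^ level G r u)"
    by (rule sum_two_step_change_le_levels[OF x r card]) auto
  thus ?thesis
    using levels by simp
qed

text \<open>\<open>\<beta>\<close> is the factor by which the bound on weighted sphere sizes grows
  per level. Cut at about \<open>log \<Delta> n\<close>, both the geometric head and the tail are of
  order \<open>n * \<rho> powr log \<Delta> n\<close>, a power of \<open>n\<close> with the claimed
  exponent.\<close>

lemma sum_level_le_powr: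
  assumes "connected_graph G" and deg: "max_degree G = \<Delta>" and \<Delta>: "\<Delta> \<ge> 2" and r: "r \<in> pverts G"
    and \<beta>: "\<beta> = real \<Delta> * (real \<Delta> / (real \<Delta> + 2))"
  shows "(\<Sum>u\<in>pverts G. (real \<Delta> / (real \<Delta> + 2)) ^ level G r u)
    \<le> (if \<Delta> = 2 then 4 else \<beta> / (\<beta> - 1) + 1)
      * real (card (pverts G)) powr (1 - degree_exponent \<Delta>)"
proof -
  interpret finite_connected_graph G
    using assms(1) by unfold_locales
  let ?n = "real (card (pverts G))"
  define \<rho> where "\<rho> = real \<Delta> / (real \<Delta> + 2)"
  have n: "?n \<ge> 1"
    using card_pos by linarith
  have \<rho>: "0 < \<rho>" "\<rho> < 1"
    using \<Delta> by (auto simp: \<rho>_def)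
  have spheres: "card (level_set G r (Suc k)) \<le> \<Delta> * (\<Delta> - 1) ^ k" for k
    using degree_le_max_degree deg by (intro card_level_set_le[OF r]) auto
  show ?thesis
  proof (cases "\<Delta> = 2")
    \<comment> \<open>Here \<open>\<beta> = 1\<close>, so the geometric formula fails. But levels
      have at most 2 nodes and \<open>\<rho> = 1 / 2\<close>, so the sum is bounded, matching the
      exponent \<open>1 - 1 = 0\<close>.\<close>
    case True
    obtain K where "(\<Sum>u\<in>pverts G. \<rho> ^ level G r u) = (\<Sum>k<K. real (card (level_set G r k)) * \<rho> ^ k)"
      by (rule obtain_levels)
    also have "\<dots> \<le> (\<Sum>k<K. 2 * (1 / 2) ^ k)"
    proof (rule sum_mono)
      fix k
      have "card (level_set G r k) \<le> 2"
        using spheres[of "k - 1"] level_set_0[OF r] True by (cases k) auto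
      thus "real (card (level_set G r k)) * \<rho> ^ k \<le> 2 * (1 / 2) ^ k"
        using True by (simp add: \<rho>_def)
    qed
    also have "\<dots> = 2 * (\<Sum>k<K. (1 / 2) ^ k)"
      by (simp add: sum_distrib_left)
    also have "\<dots> \<le> 4"
      using geometric_sum[of "1 / 2 :: real" K] by simp
    finally show ?thesis
      using True n degree_exponent_2 by (simp add: \<rho>_def)
  next
    case False
    hence \<Delta>3: "real \<Delta> \<ge> 3"
      using \<Delta> by simp
    have "real \<Delta> + 2 < 3 * real \<Delta>" "3 * real \<Delta> \<le> real \<Delta> * real \<Delta>"
      using \<Delta>3 by (auto intro: mult_right_mono)
    hence "real \<Delta> + 2 < real \<Delta> * real \<Delta>"
      by (rule less_le_trans)
    hence \<beta>1: "\<beta> > 1"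
      using \<Delta>3 by (simp add: \<beta> field_simps)
    define L where "L = log (real \<Delta>) ?n"
    have L: "L \<ge> 0" "real \<Delta> powr L = ?n"
      using n \<Delta>3 by (auto simp: L_def)
    define K where "K = nat \<lceil>L\<rceil>"
    have K: "real K \<le> L + 1" "L \<le> real K"
      using L(1) unfolding K_def by linarith+
    define M where "M = ?n * \<rho> powr L"
    have "ln \<rho> = - ln (1 + 2 / real \<Delta>)"
    proof -
      have "\<rho> = inverse (1 + 2 / real \<Delta>)"
        using \<Delta>3 by (simp add: \<rho>_def field_simps)
      thus ?thesis
        using \<Delta>3 by (simp add: ln_inverse add_pos_nonneg)
    qed
    hence "L * ln \<rho> = - degree_exponent \<Delta> * ln ?n"
      unfolding degree_exponent_eq[OF \<Delta>] by (simp add: L_def log_def)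
    hence "\<rho> powr L = ?n powr (- degree_exponent \<Delta>)"
      using \<rho> n by (auto simp: powr_def)
    hence M_eq: "M = ?n powr (1 - degree_exponent \<Delta>)"
      using n by (simp add: M_def powr_diff powr_minus divide_inverse)
    have "\<beta> powr L = M"
      using \<Delta>3 \<rho> L(2) unfolding \<beta> \<rho>_def[symmetric] by (simp add: powr_mult M_def)
    moreover have "\<beta> ^ K \<le> \<beta> powr (L + 1)"
      using \<beta>1 K(1) by (simp add: powr_realpow[symmetric])
    ultimately have \<beta>_K: "\<beta> ^ K \<le> \<beta> * M"
      using \<beta>1 by (simp add: powr_add mult.commute)
    \<comment> \<open>The coarser sphere bound \<open>\<Delta> ^ k\<close> suffices and leads to
      base-\<open>\<Delta>\<close> logarithms, as in the exponent.\<close>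
    have "real (card (level_set G r k)) * \<rho> ^ k \<le> \<beta> ^ k" for k
    proof -
      have "card (level_set G r k) \<le> \<Delta> ^ k"
      proof (cases k)
        case (Suc j)
        have "\<Delta> * (\<Delta> - 1) ^ j \<le> \<Delta> * \<Delta> ^ j"
          by (intro mult_left_mono power_mono) auto
        with spheres[of j] have "card (level_set G r (Suc j)) \<le> \<Delta> * \<Delta> ^ j"
          by (rule order_trans)
        thus ?thesis by (simp add: Suc)
      qed (simp add: level_set_0[OF r])
      hence "real (card (level_set G r k)) \<le> real \<Delta> ^ k"
        by (metis of_nat_le_iff of_nat_power)
      thus ?thesis
        using \<rho> unfolding \<beta> \<rho>_def[symmetric] power_mult_distrib by (intro mult_right_mono) auto
    qed
    hence "(\<Sum>k<K. real (card (level_set G r k)) * \<rho> ^ k) \<le> (\<Sum>k<K. \<beta> ^ k)"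
      by (intro sum_mono) auto
    also have "\<dots> = (\<beta> ^ K - 1) / (\<beta> - 1)"
      using \<beta>1 by (intro geometric_sum) auto
    also have "\<dots> \<le> \<beta> * M / (\<beta> - 1)"
      using \<beta>_K \<beta>1 by (intro divide_right_mono) auto
    finally have head: "(\<Sum>k<K. real (card (level_set G r k)) * \<rho> ^ k) \<le> \<beta> / (\<beta> - 1) * M"
      by simp
    have "\<rho> ^ K \<le> \<rho> powr L"
      using \<rho> K(2) by (simp add: powr_realpow[symmetric] powr_mono')
    hence "?n * \<rho> ^ K \<le> M"
      unfolding M_def by (intro mult_left_mono) auto
    with head have "(\<Sum>u\<in>pverts G. \<rho> ^ level G r u) \<le> (\<beta> / (\<beta> - 1) + 1) * M"
      using sum_power_level_le[of \<rho> r K] \<rho> by (simp add: distrib_right)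
    thus ?thesis
      using False unfolding M_eq \<rho>_def by simp
  qed
qed

lemma max_degree_two_step_change:
  assumes \<Delta>: "\<Delta> \<ge> 2"
  shows "\<exists>C. \<forall>G :: 'a pair_pre_digraph. connected_graph G \<and> max_degree G = \<Delta> \<longrightarrow>
    (\<forall>x\<in>configurations G. \<forall>r\<in>pverts G. \<forall>T>0.
      (\<Sum>t=1..T. two_step_change G x r t)
        \<le> C * real (card (pverts G)) powr (1 - degree_exponent \<Delta>))"
proof -
  define \<beta> where "\<beta> = real \<Delta> * (real \<Delta> / (real \<Delta> + 2))"
  define B where "B = (real \<Delta> + 1) * ((real \<Delta> + 2) / real \<Delta>)"
  define C where "C = (if \<Delta> = 2 then 4 else \<beta> / (\<beta> - 1) + 1)"
  have "(\<Sum>t=1..T. two_step_change G x r t)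
      \<le> (B * C) * real (card (pverts G)) powr (1 - degree_exponent \<Delta>)"
    if G: "connected_graph G" "max_degree G = \<Delta>"
      and x: "x \<in> configurations G" and r: "r \<in> pverts G"
    for G :: "'a pair_pre_digraph" and x r T
  proof -
    interpret finite_connected_graph G
      using G(1) by unfold_locales
    \<comment> \<open>A loop adds at most one to the degree, so \<open>D = \<Delta>\<close> serves
      both parities.\<close>
    have card: "card (loop_neighbors u) \<le> \<Delta> + 1" if "u \<in> pverts G" for u
      using degree_le_max_degree[OF that] G(2) by (simp add: card_loop_neighbors)
    have "(\<Sum>t=1..T. two_step_change G x r t)
        \<le> B * (\<Sum>u\<in>pverts G. (real \<Delta> / (real \<Delta> + 2)) ^ level G r u)"
      unfolding B_def using \<Delta> by (intro sum_two_step_change_le_levels[OF x r card]) auto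
    also have "\<dots> \<le> B * (C * real (card (pverts G)) powr (1 - degree_exponent \<Delta>))"
      unfolding C_def
      by (intro mult_left_mono sum_level_le_powr[OF G \<Delta> r \<beta>_def]) (simp add: B_def)
    finally show ?thesis
      by (simp add: mult.assoc)
  qed
  thus ?thesis
    by (intro exI[of _ "B * C"]) blast
qed

theorem theorem1:
  shows
    "(\<forall>(f :: nat \<Rightarrow> real) (\<G> :: 'a pair_pre_digraph set).
        subexponential f \<and> (\<forall>G\<in>\<G>. connected_graph G) \<and> bounded_growth f \<G> \<longrightarrow>
        (\<exists>C. \<forall>G\<in>\<G>. \<forall>x\<in>configurations G. \<forall>r\<in>pverts G. \<forall>T>0.
           (\<Sum>t=1..T. two_step_change G x r t) \<le> C))
   \<and> (\<exists>C. \<forall>G :: 'a pair_pre_digraph. connected_graph G \<and> max_degree G = 3 \<longrightarrow>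
        (\<forall>x\<in>configurations G. \<forall>r\<in>pverts G. \<forall>T>0.
           (\<Sum>t=1..T. two_step_change G x r t) \<le> C * log 2 (real (card (pverts G)))))
   \<and> (\<forall>\<Delta>\<ge>2.
        degree_exponent \<Delta> > 1 / (real \<Delta> * log 2 (real \<Delta>)) \<and>
        (\<exists>C. \<forall>G :: 'a pair_pre_digraph. connected_graph G \<and> max_degree G = \<Delta> \<longrightarrow>
           (\<forall>x\<in>configurations G. \<forall>r\<in>pverts G. \<forall>T>0.
              (\<Sum>t=1..T. two_step_change G x r t)
                \<le> C * real (card (pverts G)) powr (1 - degree_exponent \<Delta>))))"
proof (intro conjI)
  show "\<forall>(f :: nat \<Rightarrow> real) (\<G> :: 'a pair_pre_digraph set).
      subexponential f \<and> (\<forall>G\<in>\<G>. connected_graph G) \<and> bounded_growth f \<G> \<longrightarrow>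
      (\<exists>C. \<forall>G\<in>\<G>. \<forall>x\<in>configurations G. \<forall>r\<in>pverts G. \<forall>T>0.
         (\<Sum>t=1..T. two_step_change G x r t) \<le> C)"
    by (intro allI impI, elim conjE, rule bounded_growth_two_step_change) simp_all
  show "\<exists>C. \<forall>G :: 'a pair_pre_digraph. connected_graph G \<and> max_degree G = 3 \<longrightarrow>
      (\<forall>x\<in>configurations G. \<forall>r\<in>pverts G. \<forall>T>0.
         (\<Sum>t=1..T. two_step_change G x r t) \<le> C * log 2 (real (card (pverts G))))"
    by (intro exI[of _ 30] allI impI ballI, elim conjE, rule degree_3_two_step_change)
qed (intro allI impI conjI degree_exponent_gt max_degree_two_step_change)

end
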